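(* The approximation ratio of the algorithm BottomUpGreedy for MSTBL is exactly $M$. That is: for every instance $(T,\mathcal{T},\vec{k})$ of MSTBL and every execution of BottomUpGreedy, its output $\mathrm{ALG}$ is feasible and satisfies $|\mathrm{OPT}|\le M\,|\mathrm{ALG}|$, where $\mathrm{OPT}$ is an optimal solution; and for every positive integer $M$ there is an instance with parameter $M$ and an execution of BottomUpGreedy on it with $|\mathrm{OPT}|=M\,|\mathrm{ALG}|$.
   Context: An object of a tree $T$ is a vertex or an edge. For a set $U$ of subtrees of $T$ and an object $o$, $\mathrm{load}(U,o)$ is the number of subtrees in $U$ containing $o$. An instance of MSTBL is a triple $(T,\mathcal{T},\vec{k})$ where $T$ is a tree, $\mathcal{T}$ is a set of subtrees of $T$ and $\vec{k}$ is a vector of non-negative integers indexed by the objects of $T$; a set $U\subseteq\mathcal{T}$ is feasible if $\mathrm{load}(U,o)\le k_o$ for every object $o$; the goal is a feasible $U$ of maximum cardinality. $T$ is rooted at an arbitrary fixed vertex $r$; for a subtree $T_i$, $\mathrm{root}(T_i)$ is its vertex closest to $r$, $\mathrm{leaves}(T_i)$ is the number of leaves of $T_i$ other than $\mathrm{root}(T_i)$, and $M=\max_{T_i\in\mathcal{T}}\mathrm{leaves}(T_i)$. Algorithm BottomUpGreedy: set $U=\emptyset$; for every vertex $v$ of $T$ in some post-order traversal of $T$ (rooted at $r$), and for every subtree $T_i\in\mathcal{T}$ with $\mathrm{root}(T_i)=v$ (in an arbitrary order), if $U\cup\{T_i\}$ is feasible then replace $U$ by $U\cup\{T_i\}$;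 finally return $U$. An execution is determined by the choice of post-order traversal and of the order of the subtrees at each vertex.
   Formalization: The bound |OPT| ≤ M|ALG| is stated for M ≥ 1; for M = 0 (only one-vertex subtrees, or an empty family) it is replaced by |OPT| ≤ |ALG|, since a single vertex with bound 1 has M = 0 but |OPT| = |ALG| = 1. *)

theory Defs
  imports Main
begin

datatype 'a ugraph = Graph (verts: "'a set") (edges: "'a set set")

definition simple_graph :: "'a ugraph \<Rightarrow> bool" where
  "simple_graph G \<longleftrightarrow> finite (verts G) \<and>
     (\<forall>e\<in>edges G. \<exists>u\<in>verts G. \<exists>v\<in>verts G. u \<noteq> v \<and> e = {u, v})"

definition adj :: "'a ugraph \<Rightarrow> 'a rel" where
  "adj G = {(u, v). {u, v} \<in> edges G}"

definition connected_graph :: "'a ugraph \<Rightarrow> bool" where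
  "connected_graph G \<longleftrightarrow> verts G \<noteq> {} \<and> (\<forall>u\<in>verts G. \<forall>v\<in>verts G. (u, v) \<in> (adj G)\<^sup>*)"

definition cycle :: "'a ugraph \<Rightarrow> 'a list \<Rightarrow> bool" where
  "cycle G xs \<longleftrightarrow> 3 \<le> length xs \<and> distinct xs \<and>
     (\<forall>i<length xs. {xs ! i, xs ! (Suc i mod length xs)} \<in> edges G)"

definition tree :: "'a ugraph \<Rightarrow> bool" where
  "tree G \<longleftrightarrow> simple_graph G \<and> connected_graph G \<and> (\<nexists>xs. cycle G xs)"

definition subtree :: "'a ugraph \<Rightarrow> 'a ugraph \<Rightarrow> bool" where
  "subtree S T \<longleftrightarrow> tree S \<and> verts S \<subseteq> verts T \<and> edges S \<subseteq> edges T"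

(* The value is meaningful only if u and v are connected in G. *)
definition graph_dist :: "'a ugraph \<Rightarrow> 'a \<Rightarrow> 'a \<Rightarrow> nat" where
  "graph_dist G u v = (LEAST n. (u, v) \<in> adj G ^^ n)"

definition degree :: "'a ugraph \<Rightarrow> 'a \<Rightarrow> nat" where
  "degree G v = card {e \<in> edges G. v \<in> e}"

datatype 'a obj = Vertex 'a | Edge "'a set"

definition objects :: "'a ugraph \<Rightarrow> 'a obj set" where
  "objects G = Vertex ` verts G \<union> Edge ` edges G"

definition load :: "'a ugraph set \<Rightarrow> 'a obj \<Rightarrow> nat" where
  "load U x = card {S \<in> U. x \<in> objects S}"

(* The load bounds k are an arbitrary function 'a obj => nat; only its values on
   the objects of T matter. *)
definition mstbl_instance :: "'a ugraph \<Rightarrow> 'a ugraph set \<Rightarrow> bool" where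
  "mstbl_instance T \<T> \<longleftrightarrow> tree T \<and> (\<forall>S\<in>\<T>. subtree S T)"

definition feasible :: "'a ugraph \<Rightarrow> 'a ugraph set \<Rightarrow> ('a obj \<Rightarrow> nat) \<Rightarrow> 'a ugraph set \<Rightarrow> bool" where
  "feasible T \<T> k U \<longleftrightarrow> U \<subseteq> \<T> \<and> (\<forall>x\<in>objects T. load U x \<le> k x)"

definition optimal :: "'a ugraph \<Rightarrow> 'a ugraph set \<Rightarrow> ('a obj \<Rightarrow> nat) \<Rightarrow> 'a ugraph set \<Rightarrow> bool" where
  "optimal T \<T> k U \<longleftrightarrow> feasible T \<T> k U \<and> (\<forall>U'. feasible T \<T> k U' \<longrightarrow> card U' \<le> card U)"

definition subtree_root :: "'a ugraph \<Rightarrow> 'a \<Rightarrow> 'a ugraph \<Rightarrow> 'a" where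
  "subtree_root T r S = arg_min_on (graph_dist T r) (verts S)"

definition leaves :: "'a ugraph \<Rightarrow> 'a \<Rightarrow> 'a ugraph \<Rightarrow> nat" where
  "leaves T r S = card {v \<in> verts S. degree S v = 1 \<and> v \<noteq> subtree_root T r S}"

(* The parameter M; the inserted 0 only matters for the empty family. *)
definition max_leaves :: "'a ugraph \<Rightarrow> 'a \<Rightarrow> 'a ugraph set \<Rightarrow> nat" where
  "max_leaves T r \<T> = Max (insert 0 (leaves T r ` \<T>))"

definition children :: "'a ugraph \<Rightarrow> 'a \<Rightarrow> 'a \<Rightarrow> 'a set" where
  "children T r v = {u. {v, u} \<in> edges T \<and> graph_dist T r u = Suc (graph_dist T r v)}"

(* post_order T r v vs: vs is a post-order traversal of the part of T below v,
   where T is rooted at r; cs is the chosen order of the children of v. *)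
inductive post_order :: "'a ugraph \<Rightarrow> 'a \<Rightarrow> 'a \<Rightarrow> 'a list \<Rightarrow> bool" for T r where
  "distinct cs \<Longrightarrow> set cs = children T r v \<Longrightarrow> list_all2 (post_order T r) cs vss \<Longrightarrow>
     post_order T r v (concat vss @ [v])"

definition greedy_step ::
    "'a ugraph \<Rightarrow> 'a ugraph set \<Rightarrow> ('a obj \<Rightarrow> nat) \<Rightarrow> 'a ugraph \<Rightarrow> 'a ugraph set \<Rightarrow> 'a ugraph set" where
  "greedy_step T \<T> k S U = (if feasible T \<T> k (insert S U) then insert S U else U)"

(* An execution is given by a post-order traversal vs of T and, for every vertex v,
   an enumeration ord v of the subtrees rooted at v. *)
definition bottom_up_greedy_output ::
    "'a ugraph \<Rightarrow> 'a ugraph set \<Rightarrow> ('a obj \<Rightarrow> nat) \<Rightarrow> 'a \<Rightarrow> 'a ugraph set \<Rightarrow> bool" where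
  "bottom_up_greedy_output T \<T> k r ALG \<longleftrightarrow>
     (\<exists>vs ord. post_order T r r vs \<and>
        (\<forall>v\<in>verts T. distinct (ord v) \<and> set (ord v) = {S \<in> \<T>. subtree_root T r S = v}) \<and>
        ALG = fold (\<lambda>v U. fold (greedy_step T \<T> k) (ord v) U) vs {})"

end

theory Submission
  imports Defs
begin

text \<open>
  Upper bound: transform an optimal solution \<open>Q\<close> into the output by following the greedy
  choices. When the algorithm accepts \<open>S\<close>, no subtree of \<open>Q\<close> that it has not yet accepted
  is rooted strictly below the root of \<open>S\<close>, so if such a subtree contains an object of \<open>S\<close>, it
  contains the whole way from this object up to the root of \<open>S\<close>. Hence, for
  each leaf of \<open>S\<close>, removing one subtree through the lowest overloaded object above this leaf
  makes room for \<open>S\<close> on the entire path from the leaf to the root of \<open>S\<close>.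

  Tightness: in a star with \<open>M\<close> edges and capacity 1 at the outer vertices, the algorithm may
  take the whole star, while the \<open>M\<close> single edges are also feasible.
\<close>

section \<open>Paths and cycles in graphs\<close>

lemma rtrancl_distinct_path:
  assumes "(a, b) \<in> R\<^sup>*"
  shows "\<exists>xs. xs \<noteq> [] \<and> hd xs = a \<and> last xs = b \<and> distinct xs \<and>
           successively (\<lambda>u v. (u, v) \<in> R) xs"
  using assms
proof (induction rule: rtrancl_induct)
  case base
  show ?case by (rule exI[of _ "[a]"]) auto
next
  case (step b c)
  then obtain xs where xs: "xs \<noteq> []" "hd xs = a" "last xs = b" "distinct xs"
    "successively (\<lambda>u v. (u, v) \<in> R) xs" by blast
  show ?case
  proof (cases "c \<in> set xs")
    case True
    \<comment> \<open>A return to \<open>c\<close> is repaired by cutting the path at the earlier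
      occurrence of \<open>c\<close>.\<close>
    then obtain ys zs where "xs = (ys @ [c]) @ zs" by (auto dest: split_list)
    then show ?thesis
      using xs by (intro exI[of _ "ys @ [c]"]) (auto simp: successively_append_iff hd_append split: if_splits)
  next
    case False
    then show ?thesis
      using xs step.hyps by (intro exI[of _ "xs @ [c]"]) (auto simp: successively_append_iff)
  qed
qed

lemma sym_adj: "sym (adj G)"
  by (auto simp: sym_def adj_def insert_commute)

lemma simple_graph_edgeD:
  assumes "simple_graph G" "{u, v} \<in> edges G"
  shows "u \<in> verts G" "v \<in> verts G" "u \<noteq> v"
proof -
  obtain a b where "a \<in> verts G" "b \<in> verts G" "a \<noteq> b" "{u, v} = {a, b}"
    using assms unfolding simple_graph_def by blast
  then show "u \<in> verts G" "v \<in> verts G" "u \<noteq> v" by (auto simp: doubleton_eq_iff)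
qed

lemma finite_edges: "simple_graph G \<Longrightarrow> finite (edges G)"
  by (rule finite_subset[of _ "Pow (verts G)"]) (auto simp: simple_graph_def)

text \<open>The vertex \<open>x\<close> closes a path between its neighbours \<open>a\<close> and
  \<open>b\<close> into a cycle. As \<open>a \<noteq> b\<close>, the path has at least two vertices
  and the cycle at least three.\<close>

lemma detour_cycle:
  assumes "{x, a} \<in> edges G" "{x, b} \<in> edges G" "a \<noteq> b" "a \<noteq> x"
    and path: "(a, b) \<in> (adj G \<inter> {(u, v). u \<noteq> x \<and> v \<noteq> x})\<^sup>*"
  shows "\<exists>xs. cycle G xs"
proof -
  let ?R = "adj G \<inter> {(u, v). u \<noteq> x \<and> v \<noteq> x}"
  obtain xs where xs: "xs \<noteq> []" "hd xs = a" "last xs = b" "distinct xs"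
    "successively (\<lambda>u v. (u, v) \<in> ?R) xs"
    using rtrancl_distinct_path[OF path] by blast
  have len: "length xs \<ge> 2"
    using xs(1-3) assms(3) by (cases xs) (auto simp: Suc_le_eq split: if_splits)
  have nth: "(xs ! i, xs ! Suc i) \<in> ?R" if "Suc i < length xs" for i
    using xs(5) that by (simp add: successively_conv_nth)
  have "x \<notin> set xs"
  proof
    assume "x \<in> set xs"
    then obtain i where i: "i < length xs" "xs ! i = x" by (auto simp: in_set_conv_nth)
    show False
    proof (cases i)
      case 0
      then show False using i xs(1,2) assms(4) by (simp add: hd_conv_nth)
    next
      case (Suc j)
      then show False using nth[of j] i by auto
    qed
  qed
  moreover have "{(x # xs) ! i, (x # xs) ! (Suc i mod length (x # xs))} \<in> edges G"
    if "i < length (x # xs)" for i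
  proof (cases i)
    case 0
    then show ?thesis using len xs(1,2) assms(1) by (simp add: hd_conv_nth)
  next
    case (Suc j)
    show ?thesis
    proof (cases "Suc j = length xs")
      \<comment> \<open>The last edge of the cycle wraps around from \<open>b\<close> to
        \<open>x\<close>.\<close>
      case True
      then have "(x # xs) ! i = b" using Suc xs(1,3) by (metis last_conv_nth diff_Suc_1 nth_Cons_Suc)
      then show ?thesis using True Suc assms(2) by (simp add: insert_commute)
    next
      case False
      then have "Suc j < length xs" using that Suc by simp
      then show ?thesis using nth[of j] Suc by (auto simp: adj_def)
    qed
  qed
  ultimately have "cycle G (x # xs)" using len xs(4) by (simp add: cycle_def)
  then show ?thesis by blast
qed

section \<open>Rooted trees and their subtrees\<close>

text \<open>Defined for any graph, since the facts on traversals are proved without assuming a tree;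
  its closures order the vertices by descent.\<close>

definition child_rel :: "'a ugraph \<Rightarrow> 'a \<Rightarrow> 'a rel" where
  "child_rel T r = {(p, v). v \<in> children T r p}"

locale rooted_tree =
  fixes T :: "'a ugraph" and r :: 'a
  assumes tree: "tree T" and root: "r \<in> verts T"
begin

abbreviation depth :: "'a \<Rightarrow> nat" where
  "depth \<equiv> graph_dist T r"

lemma simple: "simple_graph T" and connected: "connected_graph T" and acyclic: "\<not> cycle T xs"
  using tree by (auto simp: tree_def)

lemma depth_relpow:
  assumes "v \<in> verts T"
  shows "(r, v) \<in> adj T ^^ depth v"
proof -
  have "(r, v) \<in> (adj T)\<^sup>*" using connected root assms by (simp add: connected_graph_def)
  then obtain n where "(r, v) \<in> adj T ^^ n" by (auto dest: rtrancl_imp_relpow)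
  then show ?thesis unfolding graph_dist_def by (rule LeastI)
qed

lemma depth_le: "(r, v) \<in> adj T ^^ n \<Longrightarrow> depth v \<le> n"
  unfolding graph_dist_def by (rule Least_le)

lemma depth_0_iff: "v \<in> verts T \<Longrightarrow> depth v = 0 \<longleftrightarrow> v = r"
  using depth_relpow[of v] depth_le[of v 0] by auto

lemma depth_edge:
  assumes "{u, v} \<in> edges T"
  shows "depth v \<le> Suc (depth u)"
proof -
  have "u \<in> verts T" using simple assms by (rule simple_graph_edgeD)
  then have "(r, u) \<in> adj T ^^ depth u" by (rule depth_relpow)
  moreover have "(u, v) \<in> adj T" using assms by (simp add: adj_def)
  ultimately have "(r, v) \<in> adj T ^^ Suc (depth u)" by auto
  then show ?thesis by (rule depth_le)
qed

lemma lower_neighbour: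
  assumes "v \<in> verts T" "v \<noteq> r"
  obtains p where "{p, v} \<in> edges T" "depth p < depth v"
proof -
  obtain n where n: "depth v = Suc n" using assms depth_0_iff not0_implies_Suc by blast
  then obtain p where p: "(r, p) \<in> adj T ^^ n" "(p, v) \<in> adj T"
    using depth_relpow[OF assms(1)] by auto
  then show thesis using that[of p] depth_le[OF p(1)] n by (simp add: adj_def)
qed

text \<open>Repeatedly passing to a lower neighbour leads from \<open>y\<close> to \<open>r\<close>.
  All vertices after \<open>y\<close> are strictly closer to \<open>r\<close> than \<open>x\<close>,
  so the walk misses \<open>x\<close>.\<close>

lemma path_avoiding:
  assumes "y \<in> verts T" "y \<noteq> x" "depth y \<le> depth x"
  shows "(r, y) \<in> (adj T \<inter> {(u, v). u \<noteq> x \<and> v \<noteq> x})\<^sup>*"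
  using assms
proof (induction "depth y" arbitrary: y rule: less_induct)
  case less
  show ?case
  proof (cases "y = r")
    case False
    then obtain p where p: "{p, y} \<in> edges T" "depth p < depth y"
      using lower_neighbour less.prems(1) by blast
    have "p \<noteq> x" using p(2) less.prems(3) by auto
    moreover have "p \<in> verts T" using simple p(1) by (rule simple_graph_edgeD)
    ultimately have "(r, p) \<in> (adj T \<inter> {(u, v). u \<noteq> x \<and> v \<noteq> x})\<^sup>*"
      using less.hyps[of p] p(2) less.prems(3) by simp
    then show ?thesis
      by (rule rtrancl_into_rtrancl) (use p(1) \<open>p \<noteq> x\<close> less.prems(2) in \<open>simp add: adj_def\<close>)
  qed auto
qed

text \<open>Two such neighbours would both be linked to \<open>r\<close> without using
  \<open>x\<close>, hence to each other, and \<open>x\<close> would close a cycle. Allowing equal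
  depth also serves to exclude edges within one level.\<close>

lemma lower_neighbour_unique:
  assumes "{x, a} \<in> edges T" "{x, b} \<in> edges T" "depth a \<le> depth x" "depth b \<le> depth x"
  shows "a = b"
proof (rule ccontr)
  assume "a \<noteq> b"
  let ?R = "adj T \<inter> {(u, v). u \<noteq> x \<and> v \<noteq> x}"
  have ver: "a \<in> verts T" "b \<in> verts T" "x \<noteq> a" "x \<noteq> b"
    using simple_graph_edgeD[OF simple] assms(1,2) by blast+
  have "sym ?R" by (intro sym_Int sym_adj) (auto simp: sym_def)
  then have "sym (?R\<^sup>*)" by (rule sym_rtrancl)
  moreover have "(r, a) \<in> ?R\<^sup>*" "(r, b) \<in> ?R\<^sup>*"
    by (rule path_avoiding; use ver assms in simp)+
  ultimately have "(a, b) \<in> ?R\<^sup>*" by (meson rtrancl_trans symD)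
  then show False using detour_cycle[OF assms(1,2) \<open>a \<noteq> b\<close>] ver(3) acyclic by blast
qed

text \<open>The end \<open>v\<close> of larger or equal depth has a neighbour strictly closer to
  \<open>r\<close>; by uniqueness this neighbour is \<open>u\<close>, so the depths differ, and by
  exactly one.\<close>

lemma edge_child_cases:
  assumes "{u, v} \<in> edges T"
  shows "(u, v) \<in> child_rel T r \<or> (v, u) \<in> child_rel T r"
proof -
  have *: "(u, v) \<in> child_rel T r" if e: "{u, v} \<in> edges T" and le: "depth u \<le> depth v" for u v
  proof -
    have ver: "u \<in> verts T" "v \<in> verts T" "u \<noteq> v"
      using simple_graph_edgeD[OF simple e] by auto
    have "v \<noteq> r"
    proof
      assume "v = r"
      then have "depth u = 0" using le depth_0_iff[OF ver(2)] by linarith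
      then show False using depth_0_iff[OF ver(1)] ver(3) \<open>v = r\<close> by simp
    qed
    then obtain p where "{p, v} \<in> edges T" "depth p < depth v"
      using ver lower_neighbour by blast
    then have "depth u < depth v"
      using lower_neighbour_unique[of v u p] e le by (simp add: insert_commute)
    then have "depth v = Suc (depth u)" using depth_edge[OF e] by simp
    then show ?thesis using e by (simp add: child_rel_def children_def)
  qed
  have "{v, u} \<in> edges T" using assms by (simp add: insert_commute)
  then have "depth v \<le> depth u \<Longrightarrow> (v, u) \<in> child_rel T r" by (rule *)
  then show ?thesis using *[OF assms] linear[of "depth u" "depth v"] by blast
qed

lemma child_relD:
  assumes "(p, v) \<in> child_rel T r"
  shows "{p, v} \<in> edges T" "depth v = Suc (depth p)"
  using assms by (auto simp: child_rel_def children_def)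

lemma child_rel_asym:
  assumes "(p, v) \<in> child_rel T r"
  shows "(v, p) \<notin> child_rel T r"
proof
  assume "(v, p) \<in> child_rel T r"
  then have "depth p = Suc (depth v)" by (rule child_relD(2))
  moreover have "depth v = Suc (depth p)" using assms by (rule child_relD(2))
  ultimately show False by linarith
qed

lemma parent_unique:
  assumes "(p, v) \<in> child_rel T r" "(q, v) \<in> child_rel T r"
  shows "p = q"
  using lower_neighbour_unique[of v p q] assms[THEN child_relD(1)] assms[THEN child_relD(2)]
  by (simp add: insert_commute)

lemma trancl_child_depth: "(u, v) \<in> (child_rel T r)\<^sup>+ \<Longrightarrow> depth u < depth v"
  by (induction rule: trancl_induct) (auto dest: child_relD(2))

lemma descendant_root:
  assumes "v \<in> verts T"
  shows "(r, v) \<in> (child_rel T r)\<^sup>*"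
  using assms
proof (induction "depth v" arbitrary: v rule: less_induct)
  case less
  show ?case
  proof (cases "v = r")
    case False
    then obtain p where p: "{p, v} \<in> edges T" "depth p < depth v"
      using lower_neighbour less.prems by blast
    then have "(p, v) \<in> child_rel T r" using edge_child_cases child_relD(2) by fastforce
    moreover have "p \<in> verts T" using simple p(1) by (rule simple_graph_edgeD)
    ultimately show ?thesis using less.hyps[OF p(2)] by (meson rtrancl_into_rtrancl)
  qed auto
qed

section \<open>Roots and parent edges of subtrees\<close>

lemma subtreeD:
  assumes "subtree S T"
  shows "simple_graph S" "connected_graph S" "finite (verts S)" "verts S \<noteq> {}"
    "verts S \<subseteq> verts T" "edges S \<subseteq> edges T"
  using assms by (auto simp: subtree_def tree_def connected_graph_def simple_graph_def)

lemma subtree_root_in: "subtree S T \<Longrightarrow> subtree_root T r S \<in> verts S"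
  unfolding subtree_root_def by (intro arg_min_if_finite) (auto dest: subtreeD)

lemma subtree_root_le: "subtree S T \<Longrightarrow> v \<in> verts S \<Longrightarrow> depth (subtree_root T r S) \<le> depth v"
  unfolding subtree_root_def by (intro arg_min_least) (auto dest: subtreeD)

lemma no_edge_above_root:
  assumes "subtree S T" "{p, subtree_root T r S} \<in> edges S"
  shows "(p, subtree_root T r S) \<notin> child_rel T r"
  using subtree_root_le[OF assms(1) simple_graph_edgeD(1)[OF subtreeD(1)[OF assms(1)] assms(2)]]
  by (auto dest: child_relD(2))

text \<open>A walk in \<open>S\<close> that cannot leave \<open>v\<close> upwards stays below \<open>v\<close>, so it misses the root of \<open>S\<close>.\<close>

lemma parent_edge_in_subtree:
  assumes S: "subtree S T" and v: "v \<in> verts S" "v \<noteq> subtree_root T r S"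
  obtains p where "{p, v} \<in> edges S" "(p, v) \<in> child_rel T r"
proof (rule ccontr)
  assume "\<not> thesis"
  then have no: "{p, v} \<in> edges S \<Longrightarrow> (p, v) \<notin> child_rel T r" for p using that by blast
  have "(v, w) \<in> (child_rel T r)\<^sup>*" if "(v, w) \<in> (adj S)\<^sup>*" for w
    using that
  proof (induction rule: rtrancl_induct)
    case (step w w')
    then have e: "{w, w'} \<in> edges S" by (simp add: adj_def)
    then consider "(w, w') \<in> child_rel T r" | "(w', w) \<in> child_rel T r"
      using edge_child_cases subtreeD(6)[OF S] by blast
    then show ?case
    proof cases
      case 1
      then show ?thesis using step.IH by (rule rtrancl_into_rtrancl[rotated])
    next
      case 2
      then have "w \<noteq> v" using no[of w'] e by (auto simp: insert_commute)
      then obtain q where "(v, q) \<in> (child_rel T r)\<^sup>*" "(q, w) \<in> child_rel T r"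
        using step.IH by (metis rtranclE)
      then show ?thesis using parent_unique 2 by blast
    qed
  qed auto
  then have "(v, subtree_root T r S) \<in> (child_rel T r)\<^sup>*"
    using subtreeD(2)[OF S] v(1) subtree_root_in[OF S] by (simp add: connected_graph_def)
  then have "(v, subtree_root T r S) \<in> (child_rel T r)\<^sup>+"
    using v(2) by (simp add: rtrancl_eq_or_trancl)
  then show False using trancl_child_depth subtree_root_le[OF S v(1)] by fastforce
qed

text \<open>Parent edges inside \<open>S\<close> lead upwards until no such edge is left, which
  happens only at the root of \<open>S\<close>.\<close>

lemma descendant_subtree_root:
  assumes S: "subtree S T" and v: "v \<in> verts S"
  shows "(subtree_root T r S, v) \<in> (child_rel T r)\<^sup>*"
  using v
proof (induction "depth v" arbitrary: v rule: less_induct)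
  case less
  show ?case
  proof (cases "v = subtree_root T r S")
    case False
    then obtain p where p: "{p, v} \<in> edges S" "(p, v) \<in> child_rel T r"
      using parent_edge_in_subtree[OF S less.prems] by blast
    then have "p \<in> verts S" using simple_graph_edgeD(1)[OF subtreeD(1)[OF S]] by blast
    then show ?thesis using less.hyps[of p] child_relD(2) p(2) by (simp add: rtrancl_into_rtrancl)
  qed auto
qed

section \<open>Chains of objects climbing towards the root\<close>

text \<open>One step of the climb inside \<open>S\<close>. Vertices and edges alternate because both
  carry load bounds.\<close>

inductive_set object_up :: "'a ugraph \<Rightarrow> 'a obj rel" for S where
  vertex: "{p, v} \<in> edges S \<Longrightarrow> (p, v) \<in> child_rel T r \<Longrightarrow> (Vertex v, Edge {p, v}) \<in> object_up S"
| edge: "{p, v} \<in> edges S \<Longrightarrow> (p, v) \<in> child_rel T r \<Longrightarrow> (Edge {p, v}, Vertex p) \<in> object_up S"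

text \<open>A vertex has one parent and an edge one upper end. Hence the objects above a given one
  form a single chain, on which being lower means being reached in fewer steps.\<close>

lemma single_valued_object_up: "single_valued (object_up S)"
proof (rule single_valuedI)
  fix x y z assume "(x, y) \<in> object_up S" "(x, z) \<in> object_up S"
  then show "y = z"
  proof cases
    case (vertex p v)
    from \<open>(x, z) \<in> object_up S\<close> show ?thesis
    proof cases
      case (vertex q w)
      then have "q = p" using \<open>x = Vertex v\<close> \<open>(p, v) \<in> child_rel T r\<close> by (blast intro: parent_unique)
      then show ?thesis using vertex \<open>x = Vertex v\<close> \<open>y = Edge {p, v}\<close> by simp
    qed (simp add: \<open>x = Vertex v\<close>)
  next
    case (edge p v)
    from \<open>(x, z) \<in> object_up S\<close> show ?thesis
    proof cases
      case edge': (edge q w)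
      then have "q = p"
        using \<open>x = Edge {p, v}\<close> child_rel_asym[OF \<open>(p, v) \<in> child_rel T r\<close>]
        by (auto simp: doubleton_eq_iff)
      then show ?thesis using edge edge' by simp
    qed (simp add: \<open>x = Edge {p, v}\<close>)
  qed
qed

lemma object_up_vertices:
  "{p, v} \<in> edges S \<Longrightarrow> (p, v) \<in> child_rel T r \<Longrightarrow> (Vertex v, Vertex p) \<in> (object_up S)\<^sup>*"
  by (rule rtrancl_trans[OF r_into_rtrancl r_into_rtrancl, OF object_up.vertex object_up.edge])

text \<open>The vertices of \<open>S\<close> without children in \<open>S\<close>: the leaves other than the root, except that a
  one-vertex subtree has its root as a bottom vertex although its number of leaves is 0.\<close>

definition bottoms :: "'a ugraph \<Rightarrow> 'a set" where
  "bottoms S = {v \<in> verts S. \<forall>c. {v, c} \<in> edges S \<longrightarrow> (v, c) \<notin> child_rel T r}"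

text \<open>A deepest vertex of \<open>S\<close> among those climbing to \<open>v\<close> is a
  bottom, since a child of it in \<open>S\<close> would be deeper and still climb to
  \<open>v\<close>.\<close>

lemma bottom_below_vertex:
  assumes S: "subtree S T" and v: "v \<in> verts S"
  shows "\<exists>l\<in>bottoms S. (Vertex l, Vertex v) \<in> (object_up S)\<^sup>*"
proof -
  let ?D = "{u \<in> verts S. (Vertex u, Vertex v) \<in> (object_up S)\<^sup>*}"
  have fin: "finite ?D" using subtreeD(3)[OF S] by simp
  moreover have "?D \<noteq> {}" using v by blast
  ultimately obtain l where l: "l \<in> ?D" "Max (depth ` ?D) = depth l"
    by (rule obtains_MAX)
  have max: "depth u \<le> depth l" if "u \<in> ?D" for u
    unfolding l(2)[symmetric] using fin that by (intro Max_ge finite_imageI imageI)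
  have "(l, c) \<notin> child_rel T r" if "{l, c} \<in> edges S" for c
  proof
    assume c: "(l, c) \<in> child_rel T r"
    have "(Vertex c, Vertex v) \<in> (object_up S)\<^sup>*"
      using object_up_vertices[OF that c] by (rule rtrancl_trans) (use l(1) in simp)
    moreover have "c \<in> verts S" using subtreeD(1)[OF S] that by (rule simple_graph_edgeD)
    ultimately show False using max[of c] child_relD(2)[OF c] by simp
  qed
  then show ?thesis using l(1) by (auto simp: bottoms_def)
qed

text \<open>An edge is entered from its lower end. The chains from the bottoms therefore cover all
  of \<open>S\<close>, so repairing each chain repairs every object.\<close>

lemma bottom_below_object:
  assumes S: "subtree S T" and x: "x \<in> objects S"
  shows "\<exists>l\<in>bottoms S. (Vertex l, x) \<in> (object_up S)\<^sup>*"
proof (cases x)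
  case (Vertex v)
  then show ?thesis using bottom_below_vertex[OF S] x by (auto simp: objects_def)
next
  case (Edge e)
  then have "e \<in> edges S" using x by (auto simp: objects_def)
  then obtain a b where ab: "e = {a, b}" using subtreeD(1)[OF S] by (auto simp: simple_graph_def)
  then have "(a, b) \<in> child_rel T r \<or> (b, a) \<in> child_rel T r"
    using \<open>e \<in> edges S\<close> subtreeD(6)[OF S] edge_child_cases by blast
  then obtain p v where e: "e = {p, v}" "(p, v) \<in> child_rel T r"
    using ab insert_commute[of a b "{}"] by blast
  then have "(Vertex v, x) \<in> object_up S"
    using Edge \<open>e \<in> edges S\<close> object_up.vertex by simp
  moreover have "v \<in> verts S" using simple_graph_edgeD(2)[OF subtreeD(1)[OF S]] e \<open>e \<in> edges S\<close> by blast
  ultimately show ?thesis using bottom_below_vertex[OF S] by (blast intro: rtrancl_into_rtrancl)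
qed

text \<open>If the root of \<open>S\<close> is a bottom, it has no edge in \<open>S\<close>, and
  connectedness leaves only this vertex; this is the source of the \<open>1\<close>. Otherwise the
  parent edge is the only edge of \<open>S\<close> at a bottom, which is thus a leaf other than the
  root.\<close>

lemma card_bottoms:
  assumes S: "subtree S T"
  shows "finite (bottoms S)" "card (bottoms S) \<le> max 1 (leaves T r S)"
proof -
  let ?s = "subtree_root T r S"
  show fin: "finite (bottoms S)" using subtreeD(3)[OF S] by (simp add: bottoms_def)
  show "card (bottoms S) \<le> max 1 (leaves T r S)"
  proof (cases "?s \<in> bottoms S")
    case True
    have "w = ?s" if "(?s, w) \<in> (adj S)\<^sup>*" for w
      using that
    proof (induction rule: rtrancl_induct)
      case (step y z)
      then have e: "{?s, z} \<in> edges S" by (simp add: adj_def)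
      then have "(?s, z) \<in> child_rel T r \<or> (z, ?s) \<in> child_rel T r"
        using edge_child_cases subtreeD(6)[OF S] by blast
      then show ?case
        using True e no_edge_above_root[OF S, of z] insert_commute[of z ?s "{}"]
        unfolding bottoms_def by auto
    qed auto
    then have "verts S \<subseteq> {?s}"
      using subtreeD(2)[OF S] subtree_root_in[OF S] unfolding connected_graph_def by blast
    then have "bottoms S \<subseteq> {?s}" by (auto simp: bottoms_def)
    then have "card (bottoms S) \<le> 1" using card_mono[of "{?s}"] by fastforce
    then show ?thesis by simp
  next
    case False
    have "degree S v = 1" if v: "v \<in> bottoms S" for v
    proof -
      have "v \<in> verts S" "v \<noteq> ?s" using v False by (auto simp: bottoms_def)
      then obtain p where p: "{p, v} \<in> edges S" "(p, v) \<in> child_rel T r"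
        using parent_edge_in_subtree[OF S] by blast
      have "e = {p, v}" if e: "e \<in> edges S" "v \<in> e" for e
      proof -
        obtain a b where "e = {a, b}" using subtreeD(1)[OF S] e(1) unfolding simple_graph_def by blast
        then obtain w where w: "e = {v, w}" using e(2) by blast
        then have "(w, v) \<in> child_rel T r"
          using edge_child_cases[of v w] subtreeD(6)[OF S] e v unfolding bottoms_def by blast
        then have "w = p" using p(2) by (rule parent_unique)
        then show ?thesis using w by (simp add: insert_commute)
      qed
      then have "{e \<in> edges S. v \<in> e} = {{p, v}}" using p(1) by blast
      then show ?thesis by (simp add: degree_def)
    qed
    then have "bottoms S \<subseteq> {v \<in> verts S. degree S v = 1 \<and> v \<noteq> ?s}"
      using False by (auto simp: bottoms_def)
    then have "card (bottoms S) \<le> leaves T r S"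
      unfolding leaves_def using subtreeD(3)[OF S] by (intro card_mono) auto
    then show ?thesis by simp
  qed
qed

text \<open>A vertex \<open>v\<close> from which one climbs in \<open>S\<close> lies strictly below
  the root of \<open>S\<close>, so \<open>later\<close> prevents it from being the root of
  \<open>R\<close>. Thus \<open>R\<close> contains the edge from \<open>v\<close> to its parent, and
  the parent is the same for \<open>S\<close> and \<open>R\<close>.\<close>

lemma object_up_later_subtree:
  assumes S: "subtree S T" and R: "subtree R T"
    and later: "(subtree_root T r S, subtree_root T r R) \<notin> (child_rel T r)\<^sup>+"
    and "(x, z) \<in> (object_up S)\<^sup>*" "x \<in> objects R"
  shows "z \<in> objects R"
  using assms(4,5)
proof (induction rule: rtrancl_induct)
  case (step y z)
  then have y: "y \<in> objects R" by simp
  from step.hyps(2) show ?case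
  proof cases
    case (vertex p v)
    have vR: "v \<in> verts R" using y vertex by (auto simp: objects_def)
    have vS: "v \<in> verts S" using simple_graph_edgeD(2)[OF subtreeD(1)[OF S]] vertex by blast
    have "v \<noteq> subtree_root T r S" using no_edge_above_root[OF S] vertex by blast
    then have "(subtree_root T r S, v) \<in> (child_rel T r)\<^sup>+"
      using descendant_subtree_root[OF S vS] by (auto simp: rtrancl_eq_or_trancl)
    then have "v \<noteq> subtree_root T r R" using later by blast
    then obtain q where "{q, v} \<in> edges R" "(q, v) \<in> child_rel T r"
      using parent_edge_in_subtree[OF R vR] by blast
    moreover from this have "q = p" using \<open>(p, v) \<in> child_rel T r\<close> by (blast intro: parent_unique)
    ultimately show ?thesis using \<open>z = Edge {p, v}\<close> by (simp add: objects_def)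
  next
    case (edge p v)
    have "{p, v} \<in> edges R" using y edge by (auto simp: objects_def)
    then show ?thesis
      using simple_graph_edgeD(1)[OF subtreeD(1)[OF R]] edge by (auto simp: objects_def)
  qed
qed

section \<open>The exchange argument\<close>

text \<open>A subtree is determined by its vertex and edge sets, so finiteness, on which all
  cardinalities here rest, is inherited from \<open>T\<close>.\<close>

lemma finite_family:
  assumes "\<forall>S\<in>\<T>. subtree S T"
  shows "finite \<T>"
proof (rule finite_subset)
  show "\<T> \<subseteq> (\<lambda>(V, E). Graph V E) ` (Pow (verts T) \<times> Pow (edges T))"
  proof
    fix S assume "S \<in> \<T>"
    then have "verts S \<subseteq> verts T" "edges S \<subseteq> edges T" using assms subtreeD by blast+
    then show "S \<in> (\<lambda>(V, E). Graph V E) ` (Pow (verts T) \<times> Pow (edges T))"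
      by (cases S) auto
  qed
  show "finite ((\<lambda>(V, E). Graph V E) ` (Pow (verts T) \<times> Pow (edges T)))"
    using simple finite_edges[OF simple] by (auto simp: simple_graph_def)
qed

lemma load_mono: "finite V \<Longrightarrow> U \<subseteq> V \<Longrightarrow> load U x \<le> load V x"
  unfolding load_def by (intro card_mono) auto

lemma feasible_subset: "finite \<T> \<Longrightarrow> feasible T \<T> k V \<Longrightarrow> U \<subseteq> V \<Longrightarrow> feasible T \<T> k U"
  unfolding feasible_def by (meson load_mono finite_subset order_trans subset_trans)

text \<open>For each bottom vertex of \<open>S\<close>, a subtree of \<open>Q - A\<close> through the lowest overloaded
  object above it contains all overloaded objects above it.\<close>

lemma greedy_exchange:
  assumes fam: "\<forall>S\<in>\<T>. subtree S T"
    and Q: "feasible T \<T> k Q" and SA: "feasible T \<T> k (insert S A)"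
    and A: "A \<subseteq> Q" and S: "S \<in> \<T>" "S \<notin> Q"
    and later: "\<And>R. R \<in> Q - A \<Longrightarrow> (subtree_root T r S, subtree_root T r R) \<notin> (child_rel T r)\<^sup>+"
  shows "\<exists>D \<subseteq> Q - A. card D \<le> max 1 (leaves T r S) \<and> feasible T \<T> k (insert S Q - D)"
proof -
  have fin: "finite \<T>" using fam by (rule finite_family)
  have QT: "Q \<subseteq> \<T>" using Q by (simp add: feasible_def)
  then have finQ: "finite Q" using fin by (rule finite_subset)
  have subS: "subtree S T" using fam S by blast
  define B where "B = {x \<in> objects T. k x < load (insert S Q) x}"
  have load_ins: "load (insert S Q) x = (if x \<in> objects S then Suc (load Q x) else load Q x)" for x
  proof -
    have "{R \<in> insert S Q. x \<in> objects R} =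
      (if x \<in> objects S then insert S {R \<in> Q. x \<in> objects R} else {R \<in> Q. x \<in> objects R})"
      by auto
    then show ?thesis using finQ S(2) by (simp add: load_def)
  qed
  \<comment> \<open>\<open>Q\<close> is feasible, so only objects of \<open>S\<close> can become
    overloaded.\<close>
  have BS: "x \<in> objects S" if "x \<in> B" for x
    using that Q load_ins[of x] by (auto simp: B_def feasible_def not_le[symmetric] split: if_splits)
  \<comment> \<open>\<open>insert S A\<close> is feasible, so the overload must involve a member of
    \<open>Q - A\<close>.\<close>
  have hit: "\<exists>R\<in>Q - A. x \<in> objects R" if x: "x \<in> B" for x
  proof (rule ccontr)
    assume "\<not> ?thesis"
    then have "{R \<in> insert S Q. x \<in> objects R} = {R \<in> insert S A. x \<in> objects R}" using A by auto
    then have "load (insert S Q) x = load (insert S A) x" by (simp add: load_def)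
    then show False using x SA by (auto simp: B_def feasible_def not_le[symmetric])
  qed
  \<comment> \<open>The overloaded objects on the chain from \<open>l\<close> upwards.\<close>
  define C where "C l = {x \<in> B. (Vertex l, x) \<in> (object_up S)\<^sup>*}" for l
  have "\<exists>R\<in>Q - A. C l \<subseteq> objects R" if "C l \<noteq> {}" for l
  proof -
    \<comment> \<open>The least \<open>n\<close> with \<open>N n\<close> yields the lowest
      overloaded object \<open>x\<close> above \<open>l\<close>.\<close>
    define N where "N n \<longleftrightarrow> (\<exists>x\<in>C l. (Vertex l, x) \<in> object_up S ^^ n)" for n
    have "\<exists>n. N n" using that rtrancl_imp_relpow unfolding N_def C_def by blast
    define n where "n = (LEAST n. N n)"
    have "N n" unfolding n_def using \<open>\<exists>n. N n\<close> by (rule LeastI_ex)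
    then obtain x where x: "x \<in> C l" "(Vertex l, x) \<in> object_up S ^^ n"
      unfolding N_def by blast
    obtain R where R: "R \<in> Q - A" "x \<in> objects R" using hit x(1) by (auto simp: C_def)
    have "z \<in> objects R" if z: "z \<in> C l" for z
    proof -
      obtain m where m: "(Vertex l, z) \<in> object_up S ^^ m"
        using z rtrancl_imp_relpow unfolding C_def by blast
      then have "N m" using z by (auto simp: N_def)
      then have "n \<le> m" unfolding n_def by (rule Least_le)
      then have "(Vertex l, z) \<in> object_up S ^^ n O object_up S ^^ (m - n)"
        using m by (simp flip: relpow_add)
      then obtain y where y: "(Vertex l, y) \<in> object_up S ^^ n" "(y, z) \<in> object_up S ^^ (m - n)"
        by blast
      \<comment> \<open>The chain is unique, so the climb from \<open>l\<close> to \<open>z\<close>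
        passes \<open>x\<close> after \<open>n\<close> steps, and \<open>R\<close>, which contains
        \<open>x\<close>, must also contain \<open>z\<close>.\<close>
      have "y = x"
        using single_valued_relpow[OF single_valued_object_up] y(1) x(2) by (rule single_valuedD)
      then have "(x, z) \<in> (object_up S)\<^sup>*" using y(2) by (simp add: relpow_imp_rtrancl)
      then show ?thesis
        using object_up_later_subtree[OF subS _ later[OF R(1)]] R QT fam by blast
    qed
    then show ?thesis using R(1) by blast
  qed
  then obtain h where h: "\<And>l. C l \<noteq> {} \<Longrightarrow> h l \<in> Q - A \<and> C l \<subseteq> objects (h l)" by metis
  define D where "D = h ` {l \<in> bottoms S. C l \<noteq> {}}"
  have D: "D \<subseteq> Q - A" using h by (auto simp: D_def)
  have "card D \<le> card {l \<in> bottoms S. C l \<noteq> {}}"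
    unfolding D_def using card_bottoms(1)[OF subS] by (intro card_image_le) auto
  also have "\<dots> \<le> card (bottoms S)" using card_bottoms(1)[OF subS] by (intro card_mono) auto
  also have "\<dots> \<le> max 1 (leaves T r S)" by (rule card_bottoms(2)[OF subS])
  finally have "card D \<le> max 1 (leaves T r S)" .
  moreover have "feasible T \<T> k (insert S Q - D)"
    unfolding feasible_def
  proof (intro conjI ballI)
    show "insert S Q - D \<subseteq> \<T>" using QT S(1) by blast
    fix x assume xT: "x \<in> objects T"
    show "load (insert S Q - D) x \<le> k x"
    proof (cases "x \<in> B")
      case False
      then have "load (insert S Q) x \<le> k x" using xT by (simp add: B_def)
      then show ?thesis using load_mono[of "insert S Q" "insert S Q - D" x] finQ by simp
    next
      case True
      then obtain l where l: "l \<in> bottoms S" "x \<in> C l"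
        using bottom_below_object[OF subS BS] by (auto simp: C_def)
      then have R: "h l \<in> D" "x \<in> objects (h l)" using h[of l] by (auto simp: D_def)
      then have "h l \<in> Q" using D by blast
      \<comment> \<open>It is enough to trade the single subtree \<open>h l\<close> for
        \<open>S\<close>: both contain \<open>x\<close>, so the load of \<open>x\<close> stays as in
        \<open>Q\<close>.\<close>
      have "load (insert S Q - D) x \<le> load (insert S (Q - {h l})) x"
        using R(1) finQ by (intro load_mono) auto
      also have "\<dots> = card {P \<in> insert S (Q - {h l}). x \<in> objects P}" by (simp add: load_def)
      also have "{P \<in> insert S (Q - {h l}). x \<in> objects P} =
          insert S ({P \<in> Q. x \<in> objects P} - {h l})"
        using BS[OF True] by auto
      also have "card \<dots> = card {P \<in> Q. x \<in> objects P}"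
      proof -
        have "h l \<in> {P \<in> Q. x \<in> objects P}" using R(2) \<open>h l \<in> Q\<close> by simp
        then show ?thesis using S(2) finQ by (simp add: card_Suc_Diff1 del: card_Diff_singleton card_Diff_insert)
      qed
      also have "\<dots> \<le> k x" using Q xT by (simp add: feasible_def load_def)
      finally show ?thesis .
    qed
  qed
  ultimately show ?thesis using D by blast
qed

end

section \<open>Post-order traversals and the run of the algorithm\<close>

text \<open>\<open>X\<close> holds the vertices visited before the list. This is all that the
  exchange argument uses of the order of the traversal, and it allows induction along the
  list.\<close>

fun children_first :: "'a ugraph \<Rightarrow> 'a \<Rightarrow> 'a set \<Rightarrow> 'a list \<Rightarrow> bool" where
  "children_first T r X [] \<longleftrightarrow> True"
| "children_first T r X (v # vs) \<longleftrightarrow>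
     (\<forall>w. (v, w) \<in> (child_rel T r)\<^sup>+ \<longrightarrow> w \<in> X) \<and> children_first T r (insert v X) vs"

lemma children_first_append:
  "children_first T r X (xs @ ys) \<longleftrightarrow> children_first T r X xs \<and> children_first T r (X \<union> set xs) ys"
  by (induction xs arbitrary: X) auto

lemma children_first_mono:
  "children_first T r X vs \<Longrightarrow> X \<subseteq> Y \<Longrightarrow> children_first T r Y vs"
proof (induction vs arbitrary: X Y)
  case (Cons v vs)
  then show ?case using Cons.IH[of "insert v X" "insert v Y"] by auto
qed simp

lemma children_first_concat:
  "(\<And>vs. vs \<in> set vss \<Longrightarrow> children_first T r {} vs) \<Longrightarrow> children_first T r X (concat vss)"
proof (induction vss arbitrary: X)
  case (Cons vs vss)
  then show ?case
    using children_first_mono[of T r "{}" vs X] by (auto simp: children_first_append)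
qed simp

text \<open>The traversals of the children together list exactly the strict descendants of
  \<open>v\<close>, all of them before \<open>v\<close>. The ordering claim for \<open>v\<close>
  needs this set, so both claims are proved in one induction.\<close>

lemma post_order_children_first:
  assumes "post_order T r v vs"
  shows "set vs = (child_rel T r)\<^sup>* `` {v} \<and> children_first T r {} vs"
  using assms
proof (induction rule: post_order.induct)
  case (1 cs v vss)
  have all: "list_all2 (\<lambda>c vs. set vs = (child_rel T r)\<^sup>* `` {c} \<and> children_first T r {} vs) cs vss"
    using 1(3) by (rule list_all2_mono) auto
  have "set (concat vss) = (\<Union>c\<in>set cs. (child_rel T r)\<^sup>* `` {c})"
    using all by (induction rule: list_all2_induct) auto
  also have "set cs = child_rel T r `` {v}" using 1(2) by (auto simp: child_rel_def)
  also have "(\<Union>c\<in>child_rel T r `` {v}. (child_rel T r)\<^sup>* `` {c}) = (child_rel T r)\<^sup>+ `` {v}"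
    by (auto simp: trancl_unfold_left)
  finally have set: "set (concat vss) = (child_rel T r)\<^sup>+ `` {v}" .
  have "children_first T r {} (concat vss)"
    using all by (intro children_first_concat) (auto simp: list_all2_conv_all_nth in_set_conv_nth)
  then show ?case using set by (auto simp: children_first_append rtrancl_eq_or_trancl)
qed

text \<open>Swapping the greedy choices into \<open>Q\<close> one by one costs at most \<open>m - 1\<close> elements per choice.\<close>

lemma greedy_swap_step:
  assumes fam: "mstbl_instance T \<T>" and r: "r \<in> verts T"
    and A: "A \<subseteq> Q" and Q: "feasible T \<T> k Q" and S: "S \<in> \<T>"
    and processed: "(Q - A) \<inter> P = {}"
    and below: "\<And>R. R \<in> \<T> \<Longrightarrow>
      (subtree_root T r S, subtree_root T r R) \<in> (child_rel T r)\<^sup>+ \<Longrightarrow> R \<in> P"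
    and m: "1 \<le> m" "leaves T r S \<le> m"
  shows "\<exists>Q'. greedy_step T \<T> k S A \<subseteq> Q' \<and> feasible T \<T> k Q' \<and>
           (Q' - greedy_step T \<T> k S A) \<inter> insert S P = {} \<and>
           card Q + (m - 1) * card A \<le> card Q' + (m - 1) * card (greedy_step T \<T> k S A)"
proof -
  interpret rooted_tree T r using fam r by unfold_locales (auto simp: mstbl_instance_def)
  have sub: "\<forall>S\<in>\<T>. subtree S T" using fam by (simp add: mstbl_instance_def)
  have fin: "finite \<T>" using sub by (rule finite_family)
  have QT: "Q \<subseteq> \<T>" using Q by (simp add: feasible_def)
  have finQ: "finite Q" "finite A" using QT A fin by (auto intro: finite_subset)
  consider (rej) "\<not> feasible T \<T> k (insert S A)"
    | (old) "feasible T \<T> k (insert S A)" "S \<in> Q"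
    | (new) "feasible T \<T> k (insert S A)" "S \<notin> Q" by blast
  then show ?thesis
  proof cases
    case rej
    \<comment> \<open>If \<open>S\<close> were in \<open>Q\<close>, then \<open>insert S A\<close>
      would be contained in \<open>Q\<close> and hence feasible.\<close>
    then have "S \<notin> Q" using feasible_subset[OF fin Q, of "insert S A"] A by blast
    then show ?thesis using rej A Q processed by (intro exI[of _ Q]) (auto simp: greedy_step_def)
  next
    case old
    then have "card A \<le> card (insert S A)" using finQ by (simp add: card_insert_le)
    then show ?thesis using old A Q processed by (intro exI[of _ Q]) (auto simp: greedy_step_def)
  next
    case new
    \<comment> \<open>All subtrees rooted strictly below the root of \<open>S\<close> are in
      \<open>P\<close>, which \<open>Q - A\<close> avoids.\<close>
    have "(subtree_root T r S, subtree_root T r R) \<notin> (child_rel T r)\<^sup>+" if "R \<in> Q - A" for R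
      using that below[of R] processed QT by blast
    then obtain D where D: "D \<subseteq> Q - A" "card D \<le> max 1 (leaves T r S)"
      "feasible T \<T> k (insert S Q - D)"
      using greedy_exchange[OF sub Q new(1) A S new(2)] by blast
    \<comment> \<open>\<open>Q\<close> gains \<open>S\<close> and loses at most \<open>m\<close>
      members. As \<open>S\<close> is new to \<open>A\<close>, the term
      \<open>(m - 1) * card A\<close> grows by \<open>m - 1\<close>, which pays for the
      loss.\<close>
    have SD: "S \<notin> D" "S \<notin> A" using D(1) A new(2) by auto
    have "card (insert S Q - D) = Suc (card Q) - card D"
      using D(1) finQ new(2) by (subst card_Diff_subset) (auto intro: finite_subset)
    moreover have "card D \<le> m" using D(2) m by simp
    ultimately have "card Q + (m - 1) * card A \<le>
        card (insert S Q - D) + (m - 1) * card (insert S A)"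
      using SD finQ m by (simp add: algebra_simps)
    then show ?thesis
      using new(1) D SD A processed by (intro exI[of _ "insert S Q - D"]) (auto simp: greedy_step_def)
  qed
qed

text \<open>Processing a subtree rooted at \<open>v\<close> only enlarges \<open>P\<close>, so
  \<open>P\<close> keeps containing all subtrees rooted strictly below \<open>v\<close>, and the
  single step can be iterated along \<open>L\<close> in any order.\<close>

lemma greedy_swap_block:
  assumes fam: "mstbl_instance T \<T>" and r: "r \<in> verts T"
    and "A \<subseteq> Q" "feasible T \<T> k Q" "(Q - A) \<inter> P = {}"
    and L: "\<And>S. S \<in> set L \<Longrightarrow> S \<in> \<T> \<and> subtree_root T r S = v \<and> leaves T r S \<le> m"
    and below: "\<And>R. R \<in> \<T> \<Longrightarrow> (v, subtree_root T r R) \<in> (child_rel T r)\<^sup>+ \<Longrightarrow> R \<in> P"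
    and m: "1 \<le> m"
  shows "\<exists>Q'. fold (greedy_step T \<T> k) L A \<subseteq> Q' \<and> feasible T \<T> k Q' \<and>
           (Q' - fold (greedy_step T \<T> k) L A) \<inter> (P \<union> set L) = {} \<and>
           card Q + (m - 1) * card A \<le> card Q' + (m - 1) * card (fold (greedy_step T \<T> k) L A)"
  using assms(3-7)
proof (induction L arbitrary: A Q P)
  case (Cons S L)
  let ?A = "greedy_step T \<T> k S A"
  have S: "S \<in> \<T>" "subtree_root T r S = v" "leaves T r S \<le> m" using Cons.prems(4) by auto
  obtain Q1 where Q1: "?A \<subseteq> Q1" "feasible T \<T> k Q1" "(Q1 - ?A) \<inter> insert S P = {}"
    "card Q + (m - 1) * card A \<le> card Q1 + (m - 1) * card ?A"
    using greedy_swap_step[OF fam r Cons.prems(1,2) S(1) Cons.prems(3) _ m S(3)]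
      Cons.prems(5) S(2) by blast
  obtain Q2 where "fold (greedy_step T \<T> k) L ?A \<subseteq> Q2" "feasible T \<T> k Q2"
    "(Q2 - fold (greedy_step T \<T> k) L ?A) \<inter> (insert S P \<union> set L) = {}"
    "card Q1 + (m - 1) * card ?A \<le> card Q2 + (m - 1) * card (fold (greedy_step T \<T> k) L ?A)"
    using Cons.IH[OF Q1(1-3)] Cons.prems(4,5) by (metis insertCI list.set_intros(2))
  then show ?case using Q1(4) by (intro exI[of _ Q2]) auto
qed auto

text \<open>The processed family now consists of the subtrees rooted in \<open>X\<close>. When
  \<open>v\<close> is visited, \<open>children_first\<close> has put all strict descendants of
  \<open>v\<close> into \<open>X\<close>, as the block at \<open>v\<close> requires.\<close>

lemma greedy_swap:
  assumes fam: "mstbl_instance T \<T>" and r: "r \<in> verts T"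
    and "A \<subseteq> Q" "feasible T \<T> k Q" "(Q - A) \<inter> {S \<in> \<T>. subtree_root T r S \<in> X} = {}"
    and "\<And>v. v \<in> set vs \<Longrightarrow> set (ord v) = {S \<in> \<T>. subtree_root T r S = v}"
    and "children_first T r X vs"
    and leaves: "\<And>S. S \<in> \<T> \<Longrightarrow> leaves T r S \<le> m" and m: "1 \<le> m"
  shows "\<exists>Q'. fold (\<lambda>v. fold (greedy_step T \<T> k) (ord v)) vs A \<subseteq> Q' \<and> feasible T \<T> k Q' \<and>
           (Q' - fold (\<lambda>v. fold (greedy_step T \<T> k) (ord v)) vs A) \<inter>
             {S \<in> \<T>. subtree_root T r S \<in> X \<union> set vs} = {} \<and>
           card Q + (m - 1) * card A \<le>
             card Q' + (m - 1) * card (fold (\<lambda>v. fold (greedy_step T \<T> k) (ord v)) vs A)"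
  using assms(3-7)
proof (induction vs arbitrary: A Q X)
  case (Cons v vs)
  let ?A = "fold (greedy_step T \<T> k) (ord v) A"
  have v: "set (ord v) = {S \<in> \<T>. subtree_root T r S = v}" using Cons.prems(4) by simp
  obtain Q1 where Q1: "?A \<subseteq> Q1" "feasible T \<T> k Q1"
    "(Q1 - ?A) \<inter> ({S \<in> \<T>. subtree_root T r S \<in> X} \<union> set (ord v)) = {}"
    "card Q + (m - 1) * card A \<le> card Q1 + (m - 1) * card ?A"
    using greedy_swap_block[OF fam r Cons.prems(1-3), of "ord v" v m] Cons.prems(5) v leaves m
    by auto
  have "(Q1 - ?A) \<inter> {S \<in> \<T>. subtree_root T r S \<in> insert v X} = {}" using Q1(3) v by auto
  then obtain Q2 where
    "fold (\<lambda>v. fold (greedy_step T \<T> k) (ord v)) vs ?A \<subseteq> Q2" "feasible T \<T> k Q2"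
    "(Q2 - fold (\<lambda>v. fold (greedy_step T \<T> k) (ord v)) vs ?A) \<inter>
       {S \<in> \<T>. subtree_root T r S \<in> insert v X \<union> set vs} = {}"
    "card Q1 + (m - 1) * card ?A \<le>
       card Q2 + (m - 1) * card (fold (\<lambda>v. fold (greedy_step T \<T> k) (ord v)) vs ?A)"
    using Cons.IH[OF Q1(1,2), of "insert v X"] Cons.prems(4,5) by auto
  then show ?case using Q1(4) by (intro exI[of _ Q2]) auto
qed auto

text \<open>The swapping starts with \<open>A = {}\<close>. After the traversal every subtree is
  processed, so the transformed set equals \<open>ALG\<close>; this gives feasibility and, with
  \<open>m\<close> the factor in the bound,
  \<open>card Q \<le> card ALG + (m - 1) * card ALG\<close>. The lower limit 1 of the factor covers
  families of one-vertex subtrees: they have no leaves, but accepting one may still cost one element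
  of \<open>Q\<close>.\<close>

lemma bottom_up_greedy_approx:
  assumes fam: "mstbl_instance T \<T>" and r: "r \<in> verts T"
    and out: "bottom_up_greedy_output T \<T> k r ALG" and Q: "feasible T \<T> k Q"
  shows "feasible T \<T> k ALG" "card Q \<le> max 1 (max_leaves T r \<T>) * card ALG"
proof -
  interpret rooted_tree T r using fam r by unfold_locales (auto simp: mstbl_instance_def)
  have sub: "\<forall>S\<in>\<T>. subtree S T" using fam by (simp add: mstbl_instance_def)
  have fin: "finite \<T>" using sub by (rule finite_family)
  let ?m = "max 1 (max_leaves T r \<T>)"
  obtain vs ord where vs: "post_order T r r vs"
    and ord: "\<And>v. v \<in> verts T \<Longrightarrow> set (ord v) = {S \<in> \<T>. subtree_root T r S = v}"
    and ALG: "ALG = fold (\<lambda>v. fold (greedy_step T \<T> k) (ord v)) vs {}"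
    using out unfolding bottom_up_greedy_output_def by blast
  have set_vs: "set vs = (child_rel T r)\<^sup>* `` {r}" and first: "children_first T r {} vs"
    using post_order_children_first[OF vs] by auto
  have "v \<in> verts T" if "(r, v) \<in> (child_rel T r)\<^sup>*" for v
    using that r
    by (induction rule: rtrancl_induct) (auto dest!: child_relD(1) simple_graph_edgeD(2)[OF simple])
  then have "set vs \<subseteq> verts T" using set_vs by auto
  then have ord': "set (ord v) = {S \<in> \<T>. subtree_root T r S = v}" if "v \<in> set vs" for v
    using ord that by blast
  have leaves: "leaves T r S \<le> ?m" if "S \<in> \<T>" for S
    unfolding max_leaves_def using fin that by (simp add: le_max_iff_disj Max_ge_iff)
  obtain Q' where Q': "ALG \<subseteq> Q'" "feasible T \<T> k Q'"
    "(Q' - ALG) \<inter> {S \<in> \<T>. subtree_root T r S \<in> set vs} = {}"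
    "card Q \<le> card Q' + (?m - 1) * card ALG"
    using greedy_swap[OF fam r _ Q _ ord' first leaves, of "{}"] ALG by auto
  have "verts T \<subseteq> set vs" using set_vs descendant_root by auto
  then have "Q' \<subseteq> {S \<in> \<T>. subtree_root T r S \<in> set vs}"
    using Q'(2) sub subtree_root_in subtreeD(5) unfolding feasible_def by blast
  then have "Q' = ALG" using Q'(1,3) by blast
  then show "feasible T \<T> k ALG" using Q'(2) by simp
  show "card Q \<le> ?m * card ALG"
    using Q'(4) \<open>Q' = ALG\<close> by (cases ?m) auto
qed

section \<open>A tight instance\<close>

text \<open>The centre 0 serves as the root. Both the whole tree and, as \<open>star {i}\<close>,
  its single edges have this form.\<close>

definition star :: "nat set \<Rightarrow> nat ugraph" where
  "star A = Graph (insert 0 A) ((\<lambda>i. {0, i}) ` A)"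

lemma verts_star [simp]: "verts (star A) = insert 0 A"
  and edges_star [simp]: "edges (star A) = (\<lambda>i. {0, i}) ` A"
  by (simp_all add: star_def)

lemma star_edge_iff: "0 \<notin> A \<Longrightarrow> {0, i} \<in> edges (star A) \<longleftrightarrow> i \<in> A"
  by (auto simp: doubleton_eq_iff)

lemma star_adj: "i \<in> A \<Longrightarrow> (0, i) \<in> adj (star A) \<and> (i, 0) \<in> adj (star A)"
  by (auto simp: adj_def insert_commute)

text \<open>Every edge contains 0, while 0 occurs at most once in a cycle. One position cannot meet
  all three edges between positions 0 and 1, 1 and 2, and last and 0.\<close>

lemma not_cycle_star: "\<not> cycle (star A) xs"
proof
  assume "cycle (star A) xs"
  then have len: "3 \<le> length xs" and dist: "distinct xs"
    and e: "\<And>i. i < length xs \<Longrightarrow> {xs ! i, xs ! (Suc i mod length xs)} \<in> edges (star A)"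
    by (auto simp: cycle_def)
  have zero: "xs ! i = 0 \<or> xs ! (Suc i mod length xs) = 0" if i: "i < length xs" for i
  proof -
    obtain a where "{xs ! i, xs ! (Suc i mod length xs)} = {0, a}" using e[OF i] by auto
    then show ?thesis by (auto simp: doubleton_eq_iff)
  qed
  have uniq: "i = j" if "xs ! i = 0" "xs ! j = 0" "i < length xs" "j < length xs" for i j
    using that dist nth_eq_iff_index_eq by fastforce
  have "xs \<noteq> []" using len by auto
  then have "xs ! 0 = 0 \<or> xs ! 1 = 0" "xs ! 1 = 0 \<or> xs ! 2 = 0"
    using zero[of 0] zero[of 1] len \<open>xs \<noteq> []\<close> by (simp_all add: numeral_2_eq_2)
  moreover have "xs ! (length xs - 1) = 0 \<or> xs ! 0 = 0"
    using zero[of "length xs - 1"] len by (cases xs) auto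
  ultimately show False
    using uniq[of 0 1] uniq[of 0 2] uniq[of 1 2] uniq[of "length xs - 1" 1] len \<open>xs \<noteq> []\<close>
    by (auto simp: numeral_2_eq_2)
qed

lemma tree_star:
  assumes "finite A" "0 \<notin> A"
  shows "tree (star A)"
proof -
  have to0: "(u, 0) \<in> (adj (star A))\<^sup>*" and from0: "(0, u) \<in> (adj (star A))\<^sup>*"
    if "u \<in> insert 0 A" for u
    using that star_adj[of u A] by auto
  have "connected_graph (star A)"
    unfolding connected_graph_def using to0 from0 by (auto intro: rtrancl_trans[of _ 0])
  moreover have "simple_graph (star A)"
    unfolding simple_graph_def
  proof (intro conjI ballI)
    show "finite (verts (star A))" using assms by simp
    fix e assume "e \<in> edges (star A)"
    then obtain i where "i \<in> A" "e = {0, i}" by auto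
    moreover from this have "0 \<noteq> i" using assms(2) by blast
    ultimately show "\<exists>u\<in>verts (star A). \<exists>v\<in>verts (star A). u \<noteq> v \<and> e = {u, v}"
      by (intro bexI[of _ 0] bexI[of _ i]) simp_all
  qed
  ultimately show ?thesis using not_cycle_star by (auto simp: tree_def)
qed

lemma graph_dist_star:
  assumes "i \<in> insert 0 A" "0 \<notin> A"
  shows "graph_dist (star A) 0 i = (if i = 0 then 0 else 1)"
proof (cases "i = 0")
  case True
  then show ?thesis unfolding graph_dist_def by (intro Least_equality) auto
next
  case False
  then have "(0, i) \<in> adj (star A) ^^ 1" using assms star_adj by simp
  moreover have "1 \<le> n" if "(0, i) \<in> adj (star A) ^^ n" for n
    using that False by (cases n) auto
  ultimately show ?thesis
    unfolding graph_dist_def using False by (simp add: Least_equality)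
qed

lemma subtree_root_star:
  assumes "B \<subseteq> A" "0 \<notin> A"
  shows "subtree_root (star A) 0 (star B) = 0"
proof -
  let ?d = "graph_dist (star A) 0"
  have d: "?d i = (if i = 0 then 0 else 1)" if "i \<in> verts (star B)" for i
    using graph_dist_star that assms by auto
  have "is_arg_min ?d (\<lambda>v. v \<in> verts (star B)) 0"
    by (simp add: is_arg_min_def d)
  \<comment> \<open>The root comes from a choice operator, so 0 must be shown to be the only
    minimum.\<close>
  moreover have "x = 0" if "is_arg_min ?d (\<lambda>v. v \<in> verts (star B)) x" for x
  proof (rule ccontr)
    assume "x \<noteq> 0"
    then have "?d 0 < ?d x" using that d[of 0] d[of x] by (simp add: is_arg_min_def)
    then show False using that by (auto simp: is_arg_min_def)
  qed
  ultimately show ?thesis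
    unfolding subtree_root_def arg_min_on_def arg_min_def by (rule some_equality)
qed

text \<open>In \<open>star {i}\<close> both ends have degree 1; the centre is not counted because it
  is the root.\<close>

lemma leaves_star:
  assumes "B \<subseteq> A" "0 \<notin> A"
  shows "leaves (star A) 0 (star B) = card B"
proof -
  have "degree (star B) v = 1" if "v \<in> B" for v
  proof -
    have "{e \<in> edges (star B). v \<in> e} = {{0, v}}" using that assms by auto
    then show ?thesis by (simp add: degree_def)
  qed
  moreover have "v \<noteq> 0" if "v \<in> B" for v using that assms by (metis subsetD)
  ultimately have "{v \<in> verts (star B). degree (star B) v = 1 \<and> v \<noteq> 0} = B" by auto
  then show ?thesis by (simp add: leaves_def subtree_root_star[OF assms])
qed

lemma children_star:
  assumes "0 \<notin> A"
  shows "children (star A) 0 0 = A" "i \<in> A \<Longrightarrow> children (star A) 0 i = {}"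
proof -
  show "children (star A) 0 0 = A"
  proof (intro equalityI subsetI)
    fix u assume "u \<in> children (star A) 0 0"
    then show "u \<in> A" using star_edge_iff[OF assms] by (simp add: children_def del: edges_star)
  next
    fix u assume u: "u \<in> A"
    then have "u \<noteq> 0" using assms by metis
    then show "u \<in> children (star A) 0 0"
      using u star_edge_iff[OF assms] graph_dist_star[of u A] graph_dist_star[of 0 A] assms
      by (simp add: children_def del: edges_star)
  qed
  assume i: "i \<in> A"
  then have "i \<noteq> 0" using assms by metis
  have "u \<notin> children (star A) 0 i" for u
  proof
    assume u: "u \<in> children (star A) 0 i"
    then obtain a where "{i, u} = {0, a}" by (auto simp: children_def)
    then have "u = 0" using \<open>i \<noteq> 0\<close> by (auto simp: doubleton_eq_iff)
    then show False using u graph_dist_star[of 0 A] assms by (simp add: children_def)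
  qed
  then show "children (star A) 0 i = {}" by blast
qed

lemma post_order_star:
  assumes "distinct cs" "0 \<notin> set cs"
  shows "post_order (star (set cs)) 0 0 (cs @ [0])"
proof -
  have "post_order (star (set cs)) 0 i [i]" if "i \<in> set cs" for i
    using post_order.intros[of "[]" "star (set cs)" 0 i "[]"] children_star(2)[OF assms(2) that]
    by simp
  then have "list_all2 (post_order (star (set cs)) 0) cs (map (\<lambda>i. [i]) cs)"
    by (auto simp: list_all2_conv_all_nth)
  moreover have "set cs = children (star (set cs)) 0 0"
    using children_star(1)[OF assms(2)] by simp
  ultimately have "post_order (star (set cs)) 0 0 (concat (map (\<lambda>i. [i]) cs) @ [0])"
    using assms(1) by (intro post_order.intros)
  then show ?thesis by simp
qed

lemma star_objects:
  assumes "0 \<notin> B"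
  shows "Vertex i \<in> objects (star B) \<longleftrightarrow> i = 0 \<or> i \<in> B"
    "Edge {0, i} \<in> objects (star B) \<longleftrightarrow> i \<in> B"
  using assms by (auto simp: objects_def doubleton_eq_iff)

lemma star_inject: "0 \<notin> A \<Longrightarrow> 0 \<notin> B \<Longrightarrow> star A = star B \<longleftrightarrow> A = B"
  by (metis insert_ident verts_star)

lemma bottom_up_greedy_tight:
  fixes M :: nat
  assumes M: "1 \<le> M"
  shows "\<exists>(T :: nat ugraph) \<T> k r ALG OPT.
    mstbl_instance T \<T> \<and> r \<in> verts T \<and> max_leaves T r \<T> = M \<and>
    bottom_up_greedy_output T \<T> k r ALG \<and> optimal T \<T> k OPT \<and>
    ALG \<noteq> {} \<and> card OPT = M * card ALG"
proof -
  define cs where "cs = [1..<Suc M]"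
  define T where "T = star (set cs)"
  define Q where "Q = (\<lambda>i. star {i}) ` set cs"
  define \<T> where "\<T> = insert T Q"
  \<comment> \<open>Every subtree of the family contains the centre, so capacity \<open>M\<close>
    there admits all single edges and bounds every feasible set. Capacity 1 at the outer vertices
    lets the whole star exclude every other subtree.\<close>
  define k where "k x = (if x = Vertex (0::nat) then M else 1)" for x
  have cs: "distinct cs" "0 \<notin> set cs" "card (set cs) = M" "set cs \<noteq> {}"
    using M by (auto simp: cs_def)
  have objT: "x \<in> objects T \<longleftrightarrow> x = Vertex 0 \<or> (\<exists>i\<in>set cs. x = Vertex i \<or> x = Edge {0, i})" for x
    by (auto simp: T_def objects_def)
  have sub: "subtree S T" and rootS: "subtree_root T 0 S = 0" and V0: "Vertex 0 \<in> objects S"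
    if S: "S \<in> \<T>" for S
  proof -
    obtain B where B: "S = star B" "B \<subseteq> set cs" using S by (auto simp: \<T>_def Q_def T_def)
    then have "finite B" "0 \<notin> B" using cs(2) by (auto intro: finite_subset)
    then show "subtree S T" using B tree_star by (auto simp: subtree_def T_def)
    show "subtree_root T 0 S = 0" using B subtree_root_star cs(2) by (simp add: T_def)
    show "Vertex 0 \<in> objects S" using B by (simp add: objects_def)
  qed
  have inst: "mstbl_instance T \<T>"
    using sub tree_star cs(2) by (auto simp: mstbl_instance_def T_def)
  have ml: "max_leaves T 0 \<T> = M"
  proof -
    have "leaves T 0 T = M" unfolding T_def using leaves_star[of "set cs" "set cs"] cs by simp
    moreover have "leaves T 0 (star {i}) = 1" if "i \<in> set cs" for i
      unfolding T_def using leaves_star[of "{i}" "set cs"] that cs by simp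
    then have "leaves T 0 ` Q = {1}" using cs(4) by (simp add: Q_def image_image image_constant_conv)
    ultimately have "insert 0 (leaves T 0 ` \<T>) = {0, M, 1}" by (simp add: \<T>_def)
    then show ?thesis unfolding max_leaves_def using M by simp
  qed
  have load1: "load {T} x \<le> 1" for x
    using card_mono[of "{T}" "{S \<in> {T}. x \<in> objects S}"] by (auto simp: load_def)
  have feasT: "feasible T \<T> k {T}"
    using order_trans[OF load1] M by (auto simp: feasible_def \<T>_def k_def)
  have block: "\<not> feasible T \<T> k {S, T}" if S: "S \<in> Q" "S \<noteq> T" for S
  proof
    assume feas: "feasible T \<T> k {S, T}"
    obtain i where i: "i \<in> set cs" "S = star {i}" using S by (auto simp: Q_def)
    have "i \<noteq> 0" using i cs(2) by metis
    have "Vertex i \<in> objects T" using i(1) objT by blast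
    moreover have "Vertex i \<in> objects S" using i(2) by (simp add: objects_def)
    ultimately have "{R \<in> {S, T}. Vertex i \<in> objects R} = {S, T}" by auto
    then have "load {S, T} (Vertex i) = 2" using S(2) by (simp add: load_def)
    moreover have "load {S, T} (Vertex i) \<le> k (Vertex i)"
      using feas \<open>Vertex i \<in> objects T\<close> by (auto simp: feasible_def)
    ultimately show False using \<open>i \<noteq> 0\<close> by (simp add: k_def)
  qed
  have injQ: "inj_on (\<lambda>i. star {i}) (set cs)"
  proof (rule inj_onI)
    fix x y assume "x \<in> set cs" "y \<in> set cs" "star {x} = star {y}"
    moreover from this have "0 \<notin> {x}" "0 \<notin> {y}" by (auto simp: cs_def)
    ultimately show "x = y" using star_inject[of "{x}" "{y}"] by simp
  qed
  \<comment> \<open>For \<open>M = 1\<close> the only single edge is \<open>T\<close> itself; the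
    filter keeps the enumeration at the centre free of repetitions.\<close>
  define L where "L = filter (\<lambda>S. S \<noteq> T) (map (\<lambda>i. star {i}) cs)"
  have L: "set L = Q - {T}" "distinct L"
    using cs(1) injQ by (auto simp: L_def Q_def distinct_map)
  \<comment> \<open>All subtrees are rooted at the centre, and putting \<open>T\<close> first there
    is the adverse choice.\<close>
  define ord where "ord v = (if v = 0 then T # L else [])" for v :: nat
  have "fold (greedy_step T \<T> k) L' {T} = {T}" if "set L' \<subseteq> Q - {T}" for L'
    using that
  proof (induction L')
    case (Cons S L')
    then show ?case using block[of S] by (simp add: greedy_step_def)
  qed simp
  then have foldL: "fold (greedy_step T \<T> k) (ord 0) {} = {T}"
    using L feasT by (simp add: ord_def greedy_step_def)
  have foldcs: "fold (\<lambda>v. fold (greedy_step T \<T> k) (ord v)) vs U = U" if "0 \<notin> set vs" for vs U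
    using that by (induction vs) (auto simp: ord_def)
  have "set (ord v) = {S \<in> \<T>. subtree_root T 0 S = v}" for v
    using L rootS by (auto simp: ord_def \<T>_def)
  moreover have "distinct (ord v)" for v using L by (simp add: ord_def)
  moreover have "post_order T 0 0 (cs @ [0])" unfolding T_def using cs by (intro post_order_star)
  ultimately have out: "bottom_up_greedy_output T \<T> k 0 {T}"
    unfolding bottom_up_greedy_output_def using foldL foldcs[OF cs(2), of "{}"]
    by (intro exI[of _ "cs @ [0]"] exI[of _ ord]) simp
  have cardQ: "card Q = M" unfolding Q_def using injQ cs(3) by (simp add: card_image)
  have feasQ: "feasible T \<T> k Q"
    unfolding feasible_def
  proof (intro conjI ballI)
    show "Q \<subseteq> \<T>" by (auto simp: \<T>_def)
    fix x assume x: "x \<in> objects T"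
    show "load Q x \<le> k x"
    proof (cases "x = Vertex 0")
      case True
      have "load Q x \<le> card Q" unfolding load_def by (intro card_mono) (auto simp: Q_def)
      then show ?thesis using cardQ True by (simp add: k_def)
    next
      case False
      then obtain i where i: "i \<in> set cs" "x = Vertex i \<or> x = Edge {0, i}" using x objT by blast
      have "{S \<in> Q. x \<in> objects S} \<subseteq> {star {i}}"
      proof
        fix S assume S: "S \<in> {S \<in> Q. x \<in> objects S}"
        then obtain j where j: "j \<in> set cs" "S = star {j}" by (auto simp: Q_def)
        then have "0 \<notin> {j}" by (auto simp: cs_def)
        then show "S \<in> {star {i}}" using S i False j star_objects[of "{j}" i] by auto
      qed
      then have "load Q x \<le> card {star {i}}" unfolding load_def by (intro card_mono) auto
      then show ?thesis using False by (simp add: k_def)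
    qed
  qed
  have "card U \<le> M" if U: "feasible T \<T> k U" for U
  proof -
    have "{S \<in> U. Vertex 0 \<in> objects S} = U" using U V0 by (auto simp: feasible_def)
    then have "card U = load U (Vertex 0)" by (simp add: load_def)
    also have "\<dots> \<le> k (Vertex 0)" using U objT by (simp add: feasible_def)
    finally show ?thesis by (simp add: k_def)
  qed
  then have "optimal T \<T> k Q" using feasQ cardQ by (simp add: optimal_def)
  then show ?thesis
    using inst ml out cardQ
    by (intro exI[of _ T] exI[of _ \<T>] exI[of _ k] exI[of _ 0] exI[of _ "{T}"] exI[of _ Q])
      (simp add: T_def)
qed

text \<open>For parameter 0 all subtrees are single vertices and the product with the parameter
  would vanish, so the factor there is 1. Tightness is stated over \<open>nat\<close> to have enough
  vertices for every \<open>M\<close>, and \<open>ALG \<noteq> {}\<close> excludes the trivial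
  equality \<open>0 = M * 0\<close>.\<close>

theorem theorem3:
  shows "(\<forall>(T :: 'a ugraph) \<T> k r ALG OPT.
            mstbl_instance T \<T> \<and> r \<in> verts T \<and>
            bottom_up_greedy_output T \<T> k r ALG \<and> optimal T \<T> k OPT \<longrightarrow>
              feasible T \<T> k ALG \<and>
              (max_leaves T r \<T> \<ge> 1 \<longrightarrow> card OPT \<le> max_leaves T r \<T> * card ALG) \<and>
              (max_leaves T r \<T> = 0 \<longrightarrow> card OPT \<le> card ALG)) \<and>
         (\<forall>M\<ge>1. \<exists>(T :: nat ugraph) \<T> k r ALG OPT.
            mstbl_instance T \<T> \<and> r \<in> verts T \<and> max_leaves T r \<T> = M \<and>
            bottom_up_greedy_output T \<T> k r ALG \<and> optimal T \<T> k OPT \<and>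
            ALG \<noteq> {} \<and> card OPT = M * card ALG)"
proof (intro conjI allI impI)
  fix T :: "'a ugraph" and \<T> k r ALG OPT
  assume "mstbl_instance T \<T> \<and> r \<in> verts T \<and>
    bottom_up_greedy_output T \<T> k r ALG \<and> optimal T \<T> k OPT"
  then have asm: "mstbl_instance T \<T>" "r \<in> verts T" "bottom_up_greedy_output T \<T> k r ALG"
    "feasible T \<T> k OPT"
    by (simp_all add: optimal_def)
  show "feasible T \<T> k ALG" by (rule bottom_up_greedy_approx(1)[OF asm])
  show "card OPT \<le> max_leaves T r \<T> * card ALG" if "1 \<le> max_leaves T r \<T>"
    using bottom_up_greedy_approx(2)[OF asm] that by (simp add: max_absorb2)
  show "card OPT \<le> card ALG" if "max_leaves T r \<T> = 0"
    using bottom_up_greedy_approx(2)[OF asm] that by simp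
qed (rule bottom_up_greedy_tight)

end
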